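(* In the homogeneous isotropic case, i.e. constant mass density $\rho$ and $E_{klmn}=\lambda\,\delta_{kl}\delta_{mn}+\mu\,(\delta_{km}\delta_{ln}+\delta_{kn}\delta_{lm})$ with constant Lamé parameters $\lambda,\mu$, and for polynomial degree $p_\gamma=0$ in time (combined with the Crank--Nicolson time discretization), the matrix of the discrete velocity system of the staggered DG scheme, given in the context, is symmetric.
   Context: Let $d\in\{2,3\}$. The scheme discretizes the linear elasticity system $\partial_t\boldsymbol{\sigma}-\mathbf{E}\cdot\nabla\mathbf{v}=\mathbf{S}_\sigma$, $\partial_t(\rho\mathbf{v})-\nabla\cdot\boldsymbol{\sigma}=\rho\mathbf{S}_v$, with velocity $\mathbf{v}$, symmetric stress tensor $\boldsymbol{\sigma}$, stiffness tensor $\mathbf{E}=(E_{klmn})$ and volume sources $\mathbf{S}_\sigma,\mathbf{S}_v$. Repeated indices are summed, except $i,j$, which number elements and faces. **Mesh.** $\Omega\subset\mathbb{R}^d$ is covered by $N_i$ non-overlapping simplex elements $T_i$ (triangles if $d=2$, tetrahedra if $d=3$), the main grid, with $N_j$ faces $\Gamma_j$ (edges if $d=2$). $\mathcal{B}(\Omega)$ is the set of indices of boundary faces, and $S_i$ is the set of indices $j$ such that $\Gamma_j$ is a face of $T_i$. For every $j\notin\mathcal{B}(\Omega)$ two elements share $\Gamma_j$; they are arbitrarily called left, $T_{\ell(j)}$, and right, $T_{r(j)}$. For $j\in S_i$, $\wp(i,j)$ is the index of the neighbour of $T_i$ that shares $\Gamma_j$. $\mathbf{n}_j$ is the unit normal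 on $\Gamma_j$ oriented from left to right, and $\mathbf{n}_{i,j}$ is the unit normal on $\Gamma_j$ pointing out of $T_i$. The dual element $R_j$ associated with $\Gamma_j$ is, in general, the one defined by the vertices of $\Gamma_j$ and the barycenters of $T_{\ell(j)}$ and $T_{r(j)}$ (a quadrilateral if $d=2$, a five-point element if $d=3$), and $T_{i,j}=R_j\cap T_i$. The formulas below are written for a generic face with its two neighbours; no separate formula for faces in $\mathcal{B}(\Omega)$ is part of the statement. **Basis functions.** Fix a degree $p\ge0$ in space. $\{\phi^{(i)}_\mu\}_{\mu=1}^{N_\phi}$ is the standard nodal polynomial basis of degree $p$ on the reference simplex, mapped to $T_i$ (sub- or iso-parametrically). $\{\psi^{(j)}_\kappa\}_{\kappa=1}^{N_\psi}$ is a basis of degree $p$ on $R_j$: for $d=2$ the tensor-product nodal basis on $[0,1]^2$ mapped to $R_j$; for $d=3$ the rescaled Taylor monomials of total degree at most $p$ in physical space. For $p_\gamma=0$ the space-time basis functions on $T_i\times[t^n,t^{n+1}]$ and $R_j\times[t^n,t^{n+1}]$ are these functions, taken constant in time. **Matrices** (Greek upper indices: basis and test functions; Latin lower indices: spatial components): $$(\bar M_i)^{\mu\nu}=\int_{T_i}\phi^{(i)}_\mu\phi^{(i)}_\nu\,d\mathbf{x},\qquad (M_j)^{\kappa\alpha}=\int_{R_j}\psi^{(j)}_\kappa\psi^{(j)}_\alpha\,d\mathbf{x},$$ $$(D_{i,j})^{\mu\kappa}_m=\int_{t^n}^{t^{n+1}}\Big(\int_{\Gamma_j}\phi^{(i)}_\mu\psi^{(j)}_\kappa\,(n_{i,j})_m\,dS-\int_{T_{i,j}}\partial_m\phi^{(i)}_\mu\,\psi^{(j)}_\kappa\,d\mathbf{x}\Big)dt,$$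 $$(\tilde Q_{i,j})^{\kappa\mu}_m=\int_{t^n}^{t^{n+1}}\Big(\int_{T_{i,j}}\psi^{(j)}_\kappa\,\partial_m\phi^{(i)}_\mu\,d\mathbf{x}-\int_{\Gamma_j}\psi^{(j)}_\kappa\phi^{(i)}_\mu\,s_{i,j}\,(n_j)_m\,dS\Big)dt,$$ with the sign $s_{i,j}=\frac{r(j)-2i+\ell(j)}{r(j)-\ell(j)}$, i.e. $s_{i,j}=1$ if $i=\ell(j)$ and $s_{i,j}=-1$ if $i=r(j)$. **Velocity system.** The unknowns are the velocity coefficients $\hat v^{\nu}_{i,l}$ at the new time level ($1\le i\le N_i$, $1\le\nu\le N_\phi$, $1\le l\le d$). After elimination of the stress, for each $i$, $\mu$, $k$, $$\rho\,(\bar M_i)^{\mu\nu}\hat v^\nu_{i,k}-\frac14\sum_{j\in S_i}(D_{i,j})^{\mu\kappa}_q\,(M_j^{-1})^{\kappa\alpha}\,E_{kqlm}\Big((\tilde Q_{i,j})^{\alpha\nu}_m\hat v^\nu_{i,l}+(\tilde Q_{\wp(i,j),j})^{\alpha\nu}_m\hat v^\nu_{\wp(i,j),l}\Big)=b^{\mu}_{i,k},$$ where the right-hand side $b^\mu_{i,k}$ is known from the old time level and the sources. The matrix in question is the coefficient matrix of this linear system. *)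

theory Defs
  imports "HOL-Analysis.Analysis" "Jordan_Normal_Form.Gauss_Jordan_Elimination"
    "Jordan_Normal_Form.Determinant"
begin

no_notation vec_index (infixl "$" 100)
no_notation scalar_prod (infix "\<bullet>" 70)

section \<open>Polynomials on the reference elements\<close>

definition multi_indices :: "nat \<Rightarrow> ('d::finite \<Rightarrow> nat) set" where
  "multi_indices p = {a. (\<Sum>k\<in>UNIV. a k) \<le> p}"

definition monomial :: "('d::finite \<Rightarrow> nat) \<Rightarrow> real^'d \<Rightarrow> real" where
  "monomial a x = (\<Prod>k\<in>UNIV. (x $ k) ^ a k)"

definition poly_space :: "nat \<Rightarrow> (real^'d::finite \<Rightarrow> real) set" where
  "poly_space p = {f. \<exists>c. f = (\<lambda>x. \<Sum>a\<in>multi_indices p. c a * monomial a x)}"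

definition ref_simplex :: "(real^'d::finite) set" where
  "ref_simplex = convex hull (insert 0 Basis)"

abbreviation ref_square :: "(real \<times> real) set" where
  "ref_square \<equiv> {0..1} \<times> {0..1}"

text \<open>The number of nodal functions equals the dimension of the space of polynomials
  of degree at most \<open>p\<close>, so the Kronecker property makes them a basis of that space.
  The nodes are arbitrary.\<close>

definition nodal_basis :: "nat \<Rightarrow> (nat \<Rightarrow> real^'d::finite \<Rightarrow> real) \<Rightarrow> bool" where
  "nodal_basis p f \<longleftrightarrow>
    (\<exists>X. (\<forall>m < (p + CARD('d)) choose CARD('d).
        f m \<in> poly_space p \<and> X m \<in> ref_simplex \<and>
        (\<forall>n < (p + CARD('d)) choose CARD('d). f m (X n) = of_bool (m = n))))"

definition lagrange_poly :: "nat \<Rightarrow> (nat \<Rightarrow> real) \<Rightarrow> nat \<Rightarrow> real \<Rightarrow> real" where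
  "lagrange_poly p z a s = (\<Prod>b\<in>{..p} - {a}. (s - z b) / (z a - z b))"

text \<open>Sub-parametric maps have degree 1 (or some other degree below \<open>p\<close>), iso-parametric
  maps have degree \<open>p\<close>; degree 1 remains available for \<open>p = 0\<close>.\<close>

definition simplex_map :: "nat \<Rightarrow> (real^'d::finite \<Rightarrow> real^'d) \<Rightarrow> (real^'d) set \<Rightarrow> bool" where
  "simplex_map p F T \<longleftrightarrow>
    (\<forall>k. (\<lambda>y. F y $ k) \<in> poly_space (max 1 p)) \<and>
    bij_betw F ref_simplex T \<and>
    (\<forall>y\<in>ref_simplex. inj (frechet_derivative F (at y)))"

definition square_map :: "nat \<Rightarrow> (real \<times> real \<Rightarrow> real^'d::finite) \<Rightarrow> (real^'d) set \<Rightarrow> bool" where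
  "square_map p G R \<longleftrightarrow>
    (\<exists>c. \<forall>s t. G (s, t) = (\<Sum>a\<le>max 1 p. \<Sum>b\<le>max 1 p. (s ^ a * t ^ b) *\<^sub>R c a b)) \<and>
    bij_betw G ref_square R"


section \<open>Staggered meshes\<close>

text \<open>Elements are numbered from \<open>1\<close> to \<open>num_elems\<close>, faces from \<open>1\<close> to \<open>num_faces\<close>; basis
  functions are numbered from \<open>0\<close>. The basis functions are constant in time (degree \<open>0\<close> in
  time), so \<open>phi\<close> and \<open>psi\<close> only take a space argument. The field \<open>nface j\<close> is the normal
  oriented from left to right, \<open>nout i j\<close> the one pointing out of element \<open>i\<close>.\<close>

record 'd staggered_dg =
  num_elems :: nat
  num_faces :: nat
  elem :: "nat \<Rightarrow> (real^'d) set"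
  face :: "nat \<Rightarrow> (real^'d) set"
  left :: "nat \<Rightarrow> nat"
  right :: "nat \<Rightarrow> nat"
  nface :: "nat \<Rightarrow> real^'d"
  nout :: "nat \<Rightarrow> nat \<Rightarrow> real^'d"
  deg :: nat
  phi :: "nat \<Rightarrow> nat \<Rightarrow> real^'d \<Rightarrow> real"
  npsi :: "nat \<Rightarrow> nat"
  psi :: "nat \<Rightarrow> nat \<Rightarrow> real^'d \<Rightarrow> real"
  t_old :: real
  t_new :: real

definition nphi :: "'d::finite staggered_dg \<Rightarrow> nat" where
  "nphi S = (deg S + CARD('d)) choose CARD('d)"

definition elems :: "'d::finite staggered_dg \<Rightarrow> nat set" where
  "elems S = {1..num_elems S}"

definition faces :: "'d::finite staggered_dg \<Rightarrow> nat set" where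
  "faces S = {1..num_faces S}"

definition elem_faces :: "'d::finite staggered_dg \<Rightarrow> nat \<Rightarrow> nat set" where
  "elem_faces S i = {j \<in> faces S. face S j facet_of elem S i}"

definition face_elems :: "'d::finite staggered_dg \<Rightarrow> nat \<Rightarrow> nat set" where
  "face_elems S j = {i \<in> elems S. j \<in> elem_faces S i}"

definition boundary_faces :: "'d::finite staggered_dg \<Rightarrow> nat set" where
  "boundary_faces S = {j \<in> faces S. face S j \<subseteq> frontier (\<Union>i\<in>elems S. elem S i)}"

text \<open>The other element sharing face \<open>j\<close>; only meaningful for interior faces.\<close>

definition neighbour :: "'d::finite staggered_dg \<Rightarrow> nat \<Rightarrow> nat \<Rightarrow> nat" where
  "neighbour S i j = (if i = left S j then right S j else left S j)"

definition orient :: "'d::finite staggered_dg \<Rightarrow> nat \<Rightarrow> nat \<Rightarrow> real" where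
  "orient S i j = (real (right S j) - 2 * real i + real (left S j)) / (real (right S j) - real (left S j))"

definition barycenter :: "(real^'d::finite) set \<Rightarrow> real^'d" where
  "barycenter T = (\<Sum>v | v extreme_point_of T. v) /\<^sub>R real (CARD('d) + 1)"

text \<open>For an interior face this is the union of two simplices; it need not be convex, so it
  is not the convex hull of its vertices in general.\<close>

definition dual_elem :: "'d::finite staggered_dg \<Rightarrow> nat \<Rightarrow> (real^'d) set" where
  "dual_elem S j = (\<Union>i\<in>face_elems S j. convex hull (insert (barycenter (elem S i)) (face S j)))"

definition unit_normal :: "(real^'d::finite) set \<Rightarrow> real^'d \<Rightarrow> bool" where
  "unit_normal C n \<longleftrightarrow> norm n = 1 \<and> (\<forall>x\<in>C. \<forall>y\<in>C. n \<bullet> (x - y) = 0)"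

text \<open>On a boundary face the only adjacent element counts as the left one and the number of
  the right one is a dummy.\<close>

definition staggered_mesh :: "'d::finite staggered_dg \<Rightarrow> bool" where
  "staggered_mesh S \<longleftrightarrow>
    (\<forall>i\<in>elems S. int CARD('d) simplex elem S i) \<and>
    (\<forall>i\<in>elems S. \<forall>i'\<in>elems S. i \<noteq> i' \<longrightarrow> interior (elem S i) \<inter> interior (elem S i') = {}) \<and>
    bij_betw (face S) (faces S) {C. \<exists>i\<in>elems S. C facet_of elem S i} \<and>
    (\<forall>j\<in>faces S - boundary_faces S.
      left S j \<noteq> right S j \<and> face_elems S j = {left S j, right S j}) \<and>
    (\<forall>j\<in>boundary_faces S. face_elems S j = {left S j} \<and> right S j \<notin> elems S) \<and>
    (\<forall>j\<in>faces S. unit_normal (face S j) (nface S j) \<and>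
      (\<forall>y\<in>face S j. (\<forall>x\<in>elem S (left S j). nface S j \<bullet> (x - y) \<le> 0) \<and>
        (j \<notin> boundary_faces S \<longrightarrow> (\<forall>x\<in>elem S (right S j). nface S j \<bullet> (x - y) \<ge> 0)))) \<and>
    (\<forall>i\<in>elems S. \<forall>j\<in>elem_faces S i. unit_normal (face S j) (nout S i j) \<and>
      (\<forall>x\<in>elem S i. \<forall>y\<in>face S j. nout S i j \<bullet> (x - y) \<le> 0))"


section \<open>Basis functions\<close>

definition main_basis :: "'d::finite staggered_dg \<Rightarrow> bool" where
  "main_basis S \<longleftrightarrow>
    (\<exists>f. nodal_basis (deg S) f \<and>
      (\<forall>i\<in>elems S. \<exists>F. simplex_map (deg S) F (elem S i) \<and>
        (\<forall>m < nphi S. \<forall>y\<in>ref_simplex. phi S i m (F y) = f m y)))"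

definition tensor_dual_basis :: "'d::finite staggered_dg \<Rightarrow> bool" where
  "tensor_dual_basis S \<longleftrightarrow>
    (\<exists>z. inj_on z {..deg S} \<and> z ` {..deg S} \<subseteq> {0..1} \<and>
      (\<forall>j\<in>faces S - boundary_faces S. npsi S j = (deg S + 1)\<^sup>2 \<and>
        (\<exists>G. square_map (deg S) G (dual_elem S j) \<and>
          (\<forall>a\<le>deg S. \<forall>b\<le>deg S. \<forall>s\<in>{0..1}. \<forall>t\<in>{0..1}.
            psi S j (a * (deg S + 1) + b) (G (s, t)) =
              lagrange_poly (deg S) z a s * lagrange_poly (deg S) z b t))))"

text \<open>The expansion point \<open>c\<close>, the positive scaling factors \<open>w\<close> (such as inverse powers of a
  characteristic length, possibly divided by factorials) and the enumeration \<open>e\<close> of the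
  monomials are arbitrary.\<close>

definition taylor_dual_basis :: "'d::finite staggered_dg \<Rightarrow> bool" where
  "taylor_dual_basis S \<longleftrightarrow>
    (\<forall>j\<in>faces S - boundary_faces S.
      \<exists>c w e. (\<forall>a. w a > 0) \<and> bij_betw e {..<npsi S j} (multi_indices (deg S)) \<and>
        (\<forall>m < npsi S j. \<forall>x\<in>dual_elem S j. psi S j m x = w (e m) * monomial (e m) (x - c)))"

text \<open>The dual basis functions on boundary faces are left unrestricted.\<close>

definition staggered_dg_space :: "'d::finite staggered_dg \<Rightarrow> bool" where
  "staggered_dg_space S \<longleftrightarrow> staggered_mesh S \<and> main_basis S \<and>
    (CARD('d) = 2 \<longrightarrow> tensor_dual_basis S) \<and> (CARD('d) = 3 \<longrightarrow> taylor_dual_basis S) \<and>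
    t_old S < t_new S"


section \<open>Matrices of the scheme\<close>

text \<open>Surface integral over a flat face: the face is parametrised by the reference simplex of
  dimension \<open>CARD('d) - 1\<close>, and the surface element is the square root of the Gram determinant
  of the edge vectors. The result does not depend on the order of the vertices.\<close>

definition surface_integral :: "(real^'d::finite) set \<Rightarrow> (real^'d \<Rightarrow> real) \<Rightarrow> real" where
  "surface_integral C f =
    (let v = (SOME vs. distinct vs \<and> set vs = {x. x extreme_point_of C});
         n = CARD('d) - 1;
         e = (\<lambda>a. v ! Suc a - v ! 0)
     in sqrt (Determinant.det (mat n n (\<lambda>(a, b). e a \<bullet> e b))) *
        (LINT s:{s. (\<forall>a<n. 0 \<le> s a) \<and> (\<Sum>a<n. s a) \<le> 1}|(\<Pi>\<^sub>M a\<in>{..<n}. lborel).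
           f (v ! 0 + (\<Sum>a<n. s a *\<^sub>R e a))))"

definition dphi :: "'d::finite staggered_dg \<Rightarrow> nat \<Rightarrow> nat \<Rightarrow> 'd \<Rightarrow> real^'d \<Rightarrow> real" where
  "dphi S i m k x = frechet_derivative (phi S i m) (at x within elem S i) (axis k 1)"

definition main_mass :: "'d::finite staggered_dg \<Rightarrow> nat \<Rightarrow> nat \<Rightarrow> nat \<Rightarrow> real" where
  "main_mass S i m n = (LINT x:elem S i|lebesgue. phi S i m x * phi S i n x)"

definition dual_mass :: "'d::finite staggered_dg \<Rightarrow> nat \<Rightarrow> real mat" where
  "dual_mass S j = mat (npsi S j) (npsi S j)
    (\<lambda>(a, b). LINT x:dual_elem S j|lebesgue. psi S j a x * psi S j b x)"

text \<open>\<open>None\<close> means that the mass matrix is singular, which does not occur for linearly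
  independent basis functions.\<close>

definition dual_mass_inv :: "'d::finite staggered_dg \<Rightarrow> nat \<Rightarrow> real mat" where
  "dual_mass_inv S j = (case mat_inverse (dual_mass S j) of
      Some B \<Rightarrow> B | None \<Rightarrow> 0\<^sub>m (npsi S j) (npsi S j))"

definition D_mat :: "'d::finite staggered_dg \<Rightarrow> nat \<Rightarrow> nat \<Rightarrow> nat \<Rightarrow> nat \<Rightarrow> 'd \<Rightarrow> real" where
  "D_mat S i j m a k =
    (LINT t:{t_old S..t_new S}|lebesgue.
      surface_integral (face S j) (\<lambda>x. phi S i m x * psi S j a x * nout S i j $ k)
      - (LINT x:dual_elem S j \<inter> elem S i|lebesgue. dphi S i m k x * psi S j a x))"

definition Q_mat :: "'d::finite staggered_dg \<Rightarrow> nat \<Rightarrow> nat \<Rightarrow> nat \<Rightarrow> nat \<Rightarrow> 'd \<Rightarrow> real" where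
  "Q_mat S i j a m k =
    (LINT t:{t_old S..t_new S}|lebesgue.
      (LINT x:dual_elem S j \<inter> elem S i|lebesgue. psi S j a x * dphi S i m k x)
      - surface_integral (face S j) (\<lambda>x. psi S j a x * phi S i m x * orient S i j * nface S j $ k))"


section \<open>The discrete velocity system\<close>

definition isotropic_stiffness ::
    "real \<Rightarrow> real \<Rightarrow> 'd::finite \<Rightarrow> 'd \<Rightarrow> 'd \<Rightarrow> 'd \<Rightarrow> real" where
  "isotropic_stiffness lam mu k l m n =
    lam * of_bool (k = l) * of_bool (m = n) +
    mu * (of_bool (k = m) * of_bool (l = n) + of_bool (k = n) * of_bool (l = m))"

text \<open>Left-hand side of the equation for element \<open>i\<close>, test function \<open>m\<close> and component \<open>k\<close>,
  applied to the velocity coefficients \<open>v\<close>. Every interior face of the element contributes.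
  No particular treatment of boundary faces is fixed: \<open>K\<close> is the set of the boundary faces
  that contribute as well, in which case the term of the missing neighbour is absent.\<close>

definition velocity_lhs ::
    "'d::finite staggered_dg \<Rightarrow> nat set \<Rightarrow> real \<Rightarrow> ('d \<Rightarrow> 'd \<Rightarrow> 'd \<Rightarrow> 'd \<Rightarrow> real) \<Rightarrow>
      (nat \<times> nat \<times> 'd \<Rightarrow> real) \<Rightarrow> nat \<times> nat \<times> 'd \<Rightarrow> real" where
  "velocity_lhs S K rho E v = (\<lambda>(i, m, k).
    rho * (\<Sum>n<nphi S. main_mass S i m n * v (i, n, k))
    - 1/4 * (\<Sum>j\<in>{j \<in> elem_faces S i. j \<in> boundary_faces S \<longrightarrow> j \<in> K}.
        \<Sum>a<npsi S j. \<Sum>b<npsi S j. \<Sum>q\<in>UNIV. \<Sum>r\<in>UNIV. \<Sum>l\<in>UNIV.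
          D_mat S i j m a q * dual_mass_inv S j $$ (a, b) * E k q l r *
          ((\<Sum>n<nphi S. Q_mat S i j b n r * v (i, n, l)) +
           (if j \<in> boundary_faces S then 0
            else \<Sum>n<nphi S. Q_mat S (neighbour S i j) j b n r * v (neighbour S i j, n, l)))))"

definition unknowns :: "'d::finite staggered_dg \<Rightarrow> (nat \<times> nat \<times> 'd) set" where
  "unknowns S = elems S \<times> {..<nphi S} \<times> UNIV"

text \<open>The column belonging to an unknown is the image of the corresponding unit vector.\<close>

definition velocity_matrix ::
    "'d::finite staggered_dg \<Rightarrow> nat set \<Rightarrow> real \<Rightarrow> ('d \<Rightarrow> 'd \<Rightarrow> 'd \<Rightarrow> 'd \<Rightarrow> real) \<Rightarrow>
      nat \<times> nat \<times> 'd \<Rightarrow> nat \<times> nat \<times> 'd \<Rightarrow> real" where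
  "velocity_matrix S K rho E I J = velocity_lhs S K rho E (\<lambda>J'. of_bool (J' = J)) I"

lemma velocity_lhs_add:
  "velocity_lhs S K rho E (\<lambda>J. u J + c * w J) I = velocity_lhs S K rho E u I + c * velocity_lhs S K rho E w I"
proof -
  obtain i m k where I: "I = (i, m, k)" by (cases I)
  have 1: "(\<Sum>n<N. f n * (u (g n) + c * w (g n))) = (\<Sum>n<N. f n * u (g n)) + c * (\<Sum>n<N. f n * w (g n))"
    for f :: "nat \<Rightarrow> real" and g and N :: nat
    by (simp add: sum.distrib sum_distrib_left algebra_simps)
  have 2: "x * ((a + c * b) + (if P then 0 else a' + c * b')) =
      x * (a + (if P then 0 else a')) + c * (x * (b + (if P then 0 else b')))" for x a b a' b' P
    by (simp add: algebra_simps)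
  show ?thesis
    unfolding velocity_lhs_def I prod.case 1 2 sum.distrib sum_distrib_left[symmetric]
    by (simp add: algebra_simps)
qed

lemma finite_unknowns: "finite (unknowns S)"
  by (simp add: unknowns_def elems_def)

lemma neighbour_in_elems:
  assumes "staggered_mesh S" "j \<in> elem_faces S i" "j \<notin> boundary_faces S"
  shows "neighbour S i j \<in> elems S"
proof -
  have "j \<in> faces S - boundary_faces S" using assms by (auto simp: elem_faces_def)
  then have "face_elems S j = {left S j, right S j}" using assms(1) by (auto simp: staggered_mesh_def)
  then show ?thesis by (auto simp: neighbour_def face_elems_def)
qed

lemma velocity_lhs_cong:
  assumes "staggered_mesh S" "I \<in> unknowns S" "\<And>J. J \<in> unknowns S \<Longrightarrow> u J = v J"
  shows "velocity_lhs S K rho E u I = velocity_lhs S K rho E v I"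
proof -
  obtain i m k where I: "I = (i, m, k)" by (cases I)
  have i: "i \<in> elems S" using assms(2) by (simp add: I unknowns_def)
  have 1: "u (i', n, l) = v (i', n, l)" if "i' \<in> elems S" "n < nphi S" for i' n l
    using that by (intro assms(3)) (simp add: unknowns_def)
  show ?thesis unfolding velocity_lhs_def I prod.case
    by (intro arg_cong2[where f = "(-)"] arg_cong2[where f = "(*)"] arg_cong2[where f = "(+)"] sum.cong refl if_cong)
       (auto simp: 1 i neighbour_in_elems[OF assms(1)])
qed

lemma velocity_lhs_eq_matrix:
  assumes "staggered_mesh S" "I \<in> unknowns S"
  shows "velocity_lhs S K rho E v I = (\<Sum>J\<in>unknowns S. velocity_matrix S K rho E I J * v J)"
proof -
  have z: "velocity_lhs S K rho E (\<lambda>J. 0) I = 0"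
    using velocity_lhs_add[of S K rho E "\<lambda>_. 0" 1 "\<lambda>_. 0" I] by simp
  have "velocity_lhs S K rho E (\<lambda>J'. \<Sum>J\<in>U. v J * of_bool (J' = J)) I =
      (\<Sum>J\<in>U. velocity_matrix S K rho E I J * v J)" if "finite U" for U
    using that
  proof (induction U)
    case (insert J U)
    have "(\<lambda>J'. \<Sum>J\<in>insert J U. v J * of_bool (J' = J)) =
        (\<lambda>J'. (\<Sum>J\<in>U. v J * of_bool (J' = J)) + v J * of_bool (J' = J))"
      unfolding sum.insert[OF insert.hyps] by (rule ext) (rule add.commute)
    then have "velocity_lhs S K rho E (\<lambda>J'. \<Sum>J\<in>insert J U. v J * of_bool (J' = J)) I =
        (\<Sum>J\<in>U. velocity_matrix S K rho E I J * v J) + v J * velocity_matrix S K rho E I J"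
      by (simp only: velocity_lhs_add insert.IH velocity_matrix_def)
    then show ?case
      unfolding sum.insert[OF insert.hyps] by (simp only: add.commute mult.commute[of "v J"])
  qed (simp add: z)
  from this[OF finite_unknowns]
  have "velocity_lhs S K rho E (\<lambda>J'. \<Sum>J\<in>unknowns S. v J * of_bool (J' = J)) I =
      (\<Sum>J\<in>unknowns S. velocity_matrix S K rho E I J * v J)" .
  moreover have "v J' = (\<Sum>J\<in>unknowns S. v J * of_bool (J' = J))" if "J' \<in> unknowns S" for J'
  proof -
    have "unknowns S \<inter> {J'} = {J'}" using that by auto
    then show ?thesis by (simp add: finite_unknowns)
  qed
  then have "velocity_lhs S K rho E v I =
      velocity_lhs S K rho E (\<lambda>J'. \<Sum>J\<in>unknowns S. v J * of_bool (J' = J)) I"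
    by (rule velocity_lhs_cong[OF assms])
  ultimately show ?thesis by simp
qed

end

theory Submission
  imports Defs
begin

text \<open>Why the matrix is symmetric. On a face of an element the oriented normal times the
  orientation sign is the outward normal, because a facet of a full-dimensional simplex has only
  one outward unit normal (\<open>outward_unit_normal_unique\<close>, \<open>orient_times_nface\<close>). With degree \<open>0\<close>
  in time, test and trial functions do not depend on time, so this makes the divergence matrices
  the negative transposes of the gradient matrices (\<open>D_mat_eq_minus_Q_mat\<close>).

  Substituting this, the entry of the matrix that couples element \<open>i\<close> with element \<open>i'\<close> becomes a
  mass term plus one quarter of a sum over the faces shared by \<open>i\<close> and \<open>i'\<close>, each face
  contributing the value of the bilinear form
  \<open>Q\<^sup>T (M\<^sup>-\<^sup>1 \<otimes> E) Q\<close> (\<open>velocity_matrix_entry\<close>). Every element adjacent to a face enters this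
  form through its own \<open>Q\<close> in the same way, whether it is the element carrying the test function
  or its neighbour. Hence transposing the matrix amounts to transposing the mass matrix of the
  main element, the inverse mass matrix of the dual element (\<open>dual_mass_inv_symmetric\<close>) and the
  stiffness tensor, and the last is invariant under the exchange of its two pairs of indices.\<close>

section \<open>Outward normals\<close>

text \<open>A facet of a full-dimensional set spans a hyperplane, so its unit normals agree up to sign.
  The set does not lie in that hyperplane, so only one of the two signs points outwards.\<close>

lemma outward_unit_normal_unique:
  fixes T C :: "(real^'d::finite) set"
  assumes dim: "aff_dim T = int CARD('d)" and C: "C facet_of T"
    and n: "unit_normal C n" "\<forall>x\<in>T. \<forall>y\<in>C. n \<bullet> (x - y) \<le> 0"
    and n': "unit_normal C n'" "\<forall>x\<in>T. \<forall>y\<in>C. n' \<bullet> (x - y) \<le> 0"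
  shows "n = n'"
proof -
  have norms: "norm n = 1" "norm n' = 1" using n(1) n'(1) by (auto simp: unit_normal_def)
  then have "n \<noteq> 0" "n' \<noteq> 0" by auto
  obtain y where y: "y \<in> C" using C by (auto simp: facet_of_def)
  define H where "H = (\<lambda>u. {x. u \<bullet> x = u \<bullet> y})"
  have hull: "affine hull C = H u" if "unit_normal C u" "u \<noteq> 0" for u
  proof (rule affine_dim_equal)
    have "u \<bullet> (x - y) = 0" if "x \<in> C" for x
      using \<open>unit_normal C u\<close> y that by (simp add: unit_normal_def)
    then have "C \<subseteq> H u" by (simp add: H_def inner_diff_right subset_eq)
    then show "affine hull C \<subseteq> H u"
      by (rule hull_minimal) (simp add: H_def affine_hyperplane)
    show "aff_dim (affine hull C) = aff_dim (H u)"
      using C dim \<open>u \<noteq> 0\<close> by (simp add: facet_of_def H_def aff_dim_hyperplane)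
  qed (use y in \<open>auto simp: H_def affine_hyperplane\<close>)
  from hull[OF n(1) \<open>n \<noteq> 0\<close>] hull[OF n'(1) \<open>n' \<noteq> 0\<close>]
  have same: "H n = H n'" by simp
  define c where "c = n' \<bullet> n"
  \<comment> \<open>The part of \<open>n'\<close> orthogonal to \<open>n\<close> is a direction of the common hyperplane, so it is
    orthogonal to \<open>n'\<close> as well and vanishes.\<close>
  define w where "w = n' - c *\<^sub>R n"
  have nw: "n \<bullet> w = 0"
    using norms(1) by (simp add: w_def c_def inner_diff_right inner_commute dot_square_norm)
  then have "y + w \<in> H n" by (simp add: H_def inner_add_right)
  then have "n' \<bullet> w = 0" unfolding same by (simp add: H_def inner_add_right)
  with nw have "w \<bullet> w = 0" by (subst (1) w_def) (simp add: inner_diff_left)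
  then have n'_eq: "n' = c *\<^sub>R n" by (simp add: w_def)
  then have "\<bar>c\<bar> = 1" using norms by simp
  moreover have "c \<noteq> -1"
  proof
    assume "c = -1"
    have "n \<bullet> (x - y) = 0" if "x \<in> T" for x
      using n(2) n'(2) that y \<open>c = -1\<close> by (force simp: n'_eq)
    then have "T \<subseteq> H n" by (auto simp: H_def inner_diff_right)
    then have "aff_dim T \<le> aff_dim (H n)" by (rule aff_dim_subset)
    then show False using dim \<open>n \<noteq> 0\<close> by (simp add: H_def aff_dim_hyperplane)
  qed
  ultimately have "c = 1" by linarith
  then show ?thesis using n'_eq by simp
qed

lemma unit_normal_minus: "unit_normal C n \<Longrightarrow> unit_normal C (- n)"
  by (simp add: unit_normal_def)

lemma face_elems_cases:
  assumes "staggered_mesh S" "i \<in> face_elems S j"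
  obtains (left) "i = left S j" "left S j \<noteq> right S j"
    | (right) "i = right S j" "left S j \<noteq> right S j" "j \<notin> boundary_faces S"
proof (cases "j \<in> boundary_faces S")
  case True
  then have "face_elems S j = {left S j}" "right S j \<notin> elems S"
    using assms(1) by (auto simp: staggered_mesh_def)
  moreover have "i \<in> elems S" using assms(2) by (simp add: face_elems_def)
  ultimately have "i = left S j" "left S j \<noteq> right S j" using assms(2) by auto
  then show ?thesis by (rule left)
next
  case False
  have "j \<in> faces S" using assms(2) by (simp add: face_elems_def elem_faces_def)
  with False have "left S j \<noteq> right S j" "face_elems S j = {left S j, right S j}"
    using assms(1) by (auto simp: staggered_mesh_def)
  then show ?thesis using assms(2) False left right by auto
qed

lemma orient_left: "left S j \<noteq> right S j \<Longrightarrow> orient S (left S j) j = 1"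
  by (simp add: orient_def field_simps)

lemma orient_right: "left S j \<noteq> right S j \<Longrightarrow> orient S (right S j) j = -1"
  by (simp add: orient_def field_simps)

lemma orient_times_nface:
  assumes mesh: "staggered_mesh S" and i: "i \<in> face_elems S j"
  shows "orient S i j * nface S j $ k = nout S i j $ k"
proof -
  have "i \<in> elems S" "j \<in> elem_faces S i" "j \<in> faces S"
    using i by (auto simp: face_elems_def elem_faces_def)
  have facet: "face S j facet_of elem S i"
    using \<open>j \<in> elem_faces S i\<close> by (simp add: elem_faces_def)
  have dim: "aff_dim (elem S i) = int CARD('a)"
    using mesh \<open>i \<in> elems S\<close> by (auto simp: staggered_mesh_def dest: aff_dim_simplex)
  have nout: "unit_normal (face S j) (nout S i j)"
    "\<forall>x\<in>elem S i. \<forall>y\<in>face S j. nout S i j \<bullet> (x - y) \<le> 0"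
    using mesh \<open>i \<in> elems S\<close> \<open>j \<in> elem_faces S i\<close> by (auto simp: staggered_mesh_def)
  have nface: "unit_normal (face S j) (nface S j)"
    using mesh \<open>j \<in> faces S\<close> by (auto simp: staggered_mesh_def)
  from mesh i show ?thesis
  proof (cases rule: face_elems_cases)
    case left
    have "\<forall>x\<in>elem S i. \<forall>y\<in>face S j. nface S j \<bullet> (x - y) \<le> 0"
      using mesh \<open>j \<in> faces S\<close> left(1) by (auto simp: staggered_mesh_def)
    then have "nface S j = nout S i j"
      by (rule outward_unit_normal_unique[OF dim facet nface _ nout])
    then show ?thesis using left by (simp add: orient_left)
  next
    case right
    have "\<forall>x\<in>elem S i. \<forall>y\<in>face S j. - nface S j \<bullet> (x - y) \<le> 0"
      using mesh \<open>j \<in> faces S\<close> right(1,3) by (auto simp: staggered_mesh_def)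
    then have "- nface S j = nout S i j"
      by (rule outward_unit_normal_unique[OF dim facet unit_normal_minus[OF nface] _ nout])
    from this[symmetric] show ?thesis using right by (simp add: orient_right)
  qed
qed


section \<open>Structure of the scheme matrices\<close>

text \<open>The discrete counterpart of the divergence being the negative adjoint of the gradient: the
  volume terms and the face terms of the two matrices have opposite signs, the latter once the
  normals are identified.\<close>

lemma D_mat_eq_minus_Q_mat:
  assumes "staggered_mesh S" "i \<in> face_elems S j"
  shows "D_mat S i j m a k = - Q_mat S i j a m k"
proof -
  have "psi S j a x * phi S i m x * orient S i j * nface S j $ k
      = phi S i m x * psi S j a x * nout S i j $ k" for x
    using orient_times_nface[OF assms, of k] by (simp only: mult.assoc mult.left_commute)
  then have "Q_mat S i j a m k = (LINT t:{t_old S..t_new S}|lebesgue.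
      - (surface_integral (face S j) (\<lambda>x. phi S i m x * psi S j a x * nout S i j $ k)
        - (LINT x:dual_elem S j \<inter> elem S i|lebesgue. dphi S i m k x * psi S j a x)))"
    by (simp only: Q_mat_def mult.commute[of "psi S j a _" "dphi S i m k _"] minus_diff_eq)
  also have "\<dots> = - D_mat S i j m a k"
    by (simp only: D_mat_def set_lebesgue_integral_def scaleR_minus_right
        Bochner_Integration.integral_minus)
  finally show ?thesis by (simp only: minus_minus)
qed

lemma main_mass_commute: "main_mass S i m n = main_mass S i n m"
  by (simp add: main_mass_def mult.commute)

lemma mat_inverse_symmetric:
  fixes A :: "'a::field mat"
  assumes A: "A \<in> carrier_mat n n" "transpose_mat A = A" and B: "mat_inverse A = Some B"
  shows "B \<in> carrier_mat n n" "transpose_mat B = B"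
proof -
  have AB: "A * B = 1\<^sub>m n" "B \<in> carrier_mat n n"
    using mat_inverse(2)[OF A(1) B] by auto
  show "B \<in> carrier_mat n n" by fact
  have "transpose_mat B * A = 1\<^sub>m n"
    using transpose_mult[OF A(1) AB(2)] AB(1) A(2) by simp
  then have "transpose_mat B * (A * B) = B"
    using A(1) AB(2) by (simp add: assoc_mult_mat[symmetric, of _ n n _ n _ n])
  then show "transpose_mat B = B" using AB by simp
qed

lemma dual_mass_inv_symmetric:
  assumes "a < npsi S j" "b < npsi S j"
  shows "dual_mass_inv S j $$ (a, b) = dual_mass_inv S j $$ (b, a)"
proof (cases "mat_inverse (dual_mass S j)")
  \<comment> \<open>The inverse then defaults to the zero matrix.\<close>
  case None
  then show ?thesis using assms by (simp add: dual_mass_inv_def)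
next
  case (Some B)
  have "dual_mass S j \<in> carrier_mat (npsi S j) (npsi S j)" by (simp add: dual_mass_def)
  moreover have "transpose_mat (dual_mass S j) = dual_mass S j"
    by (rule eq_matI) (simp_all add: dual_mass_def mult.commute)
  ultimately have B: "B \<in> carrier_mat (npsi S j) (npsi S j)" "transpose_mat B = B"
    using Some by (rule mat_inverse_symmetric)+
  have "B $$ (a, b) = transpose_mat B $$ (a, b)" by (simp add: B(2))
  also have "\<dots> = B $$ (b, a)" using assms B(1) by simp
  finally show ?thesis by (simp add: dual_mass_inv_def Some)
qed


section \<open>Entries of the velocity matrix\<close>

definition coupling_faces :: "'d::finite staggered_dg \<Rightarrow> nat set \<Rightarrow> nat \<Rightarrow> nat \<Rightarrow> nat set" where
  "coupling_faces S K i i' =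
    {j \<in> faces S. {i, i'} \<subseteq> face_elems S j \<and> (j \<in> boundary_faces S \<longrightarrow> j \<in> K)}"

text \<open>What a face contributes to the equation for element \<open>i\<close> when only the coefficient of
  element \<open>i'\<close> is nonzero: its own term and the term of the neighbour merge into a single
  condition on \<open>i'\<close>, since a face has no other adjacent elements.\<close>

lemma adjacent_elem_terms:
  fixes f :: "nat \<Rightarrow> real"
  assumes "staggered_mesh S" "i \<in> face_elems S j"
  shows "of_bool (i = i') * f i
      + (if j \<in> boundary_faces S then 0
         else of_bool (neighbour S i j = i') * f (neighbour S i j))
    = of_bool (i' \<in> face_elems S j) * f i'"
proof (cases "j \<in> boundary_faces S")
  case True
  then have "face_elems S j = {left S j}" using assms(1) by (auto simp: staggered_mesh_def)
  then show ?thesis using True assms(2) by auto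
next
  case False
  have "j \<in> faces S" using assms(2) by (simp add: face_elems_def elem_faces_def)
  with False have "left S j \<noteq> right S j" "face_elems S j = {left S j, right S j}"
    using assms(1) by (auto simp: staggered_mesh_def)
  then show ?thesis using False assms(2) by (auto simp: neighbour_def)
qed

lemma sum_of_bool_triple:
  fixes f :: "nat \<Rightarrow> real"
  assumes "n' < N"
  shows "(\<Sum>n<N. f n * of_bool ((i, n, k) = (i', n', l))) = of_bool (i = i' \<and> k = l) * f n'"
proof -
  have "(\<Sum>n<N. f n * of_bool ((i, n, k) = (i', n', l)))
      = (\<Sum>n<N. if n = n' then of_bool (i = i' \<and> k = l) * f n else 0)"
    by (intro sum.cong) auto
  then show ?thesis using assms by simp
qed

lemma velocity_matrix_entry:
  fixes S :: "'d::finite staggered_dg"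
  assumes mesh: "staggered_mesh S" and i: "i \<in> elems S" and n: "n < nphi S"
  shows "velocity_matrix S K rho E (i, m, k) (i', n, l) =
    rho * of_bool (i = i' \<and> k = l) * main_mass S i m n
    + 1/4 * (\<Sum>j\<in>coupling_faces S K i i'. \<Sum>a<npsi S j. \<Sum>b<npsi S j. \<Sum>q\<in>UNIV. \<Sum>r\<in>UNIV.
        Q_mat S i j a m q * dual_mass_inv S j $$ (a, b) * E k q l r * Q_mat S i' j b n r)"
proof -
  define F where "F = {j \<in> elem_faces S i. j \<in> boundary_faces S \<longrightarrow> j \<in> K}"
  define g where "g = (\<lambda>j. \<Sum>a<npsi S j. \<Sum>b<npsi S j. \<Sum>q\<in>UNIV. \<Sum>r\<in>UNIV.
      Q_mat S i j a m q * dual_mass_inv S j $$ (a, b) * E k q l r * Q_mat S i' j b n r)"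
  have fin: "finite F" by (simp add: F_def elem_faces_def faces_def)
  define c where "c = (\<lambda>j. (\<Sum>a<npsi S j. \<Sum>b<npsi S j. \<Sum>q\<in>UNIV. \<Sum>r\<in>UNIV. \<Sum>l'\<in>UNIV.
        D_mat S i j m a q * dual_mass_inv S j $$ (a, b) * E k q l' r *
        ((\<Sum>n'<nphi S. Q_mat S i j b n' r * of_bool ((i, n', l') = (i', n, l))) +
         (if j \<in> boundary_faces S then 0
          else \<Sum>n'<nphi S. Q_mat S (neighbour S i j) j b n' r *
            of_bool ((neighbour S i j, n', l') = (i', n, l))))))"
  have face: "c j = - (if i' \<in> face_elems S j then g j else 0)" if "j \<in> F" for j
  proof -
    have ij: "i \<in> face_elems S j" using that i by (simp add: F_def face_elems_def)
    have bracket: "(\<Sum>n'<nphi S. Q_mat S i j b n' r * of_bool ((i, n', l') = (i', n, l))) +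
         (if j \<in> boundary_faces S then 0
          else \<Sum>n'<nphi S. Q_mat S (neighbour S i j) j b n' r *
            of_bool ((neighbour S i j, n', l') = (i', n, l)))
        = (if l' = l then of_bool (i' \<in> face_elems S j) * Q_mat S i' j b n r else 0)" for b r l'
    proof (cases "l' = l")
      case True
      show ?thesis
        using adjacent_elem_terms[OF mesh ij, of i' "\<lambda>i. Q_mat S i j b n r"]
        unfolding sum_of_bool_triple[OF n] True by (simp only: simp_thms if_True cong: if_cong)
    qed (simp add: sum_of_bool_triple[OF n])
    have "(\<Sum>l'\<in>UNIV. D_mat S i j m a q * dual_mass_inv S j $$ (a, b) * E k q l' r *
          (if l' = l then of_bool (i' \<in> face_elems S j) * Q_mat S i' j b n r else 0))
        = - (of_bool (i' \<in> face_elems S j) *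
          (Q_mat S i j a m q * dual_mass_inv S j $$ (a, b) * E k q l r * Q_mat S i' j b n r))"
      for a b q r
      by (simp add: D_mat_eq_minus_Q_mat[OF mesh ij] if_distrib[of "\<lambda>x. _ * x"] cong: if_cong)
    then show ?thesis
      unfolding c_def bracket by (simp add: g_def sum_negf)
  qed
  have "coupling_faces S K i i' = F \<inter> {j. i' \<in> face_elems S j}"
    using i by (auto simp: coupling_faces_def F_def face_elems_def elem_faces_def)
  then have "sum c F = - sum g (coupling_faces S K i i')"
    using fin by (simp add: face sum_negf sum.inter_restrict)
  then have "velocity_matrix S K rho E (i, m, k) (i', n, l) =
      rho * (\<Sum>n'<nphi S. main_mass S i m n' * of_bool ((i, n', k) = (i', n, l)))
      - 1/4 * - sum g (coupling_faces S K i i')"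
    by (simp only: velocity_matrix_def velocity_lhs_def prod.case F_def[symmetric] c_def)
  then show ?thesis
    unfolding sum_of_bool_triple[OF n] g_def by simp
qed

text \<open>Transposition exchanges, in every face contribution, the two copies of \<open>Q\<close>, the indices of
  the inverse dual mass matrix and the two pairs of indices of the stiffness tensor. All three
  exchanges only rename summation indices when the tensor has its major symmetry.\<close>

lemma velocity_matrix_symmetric:
  fixes S :: "'d::finite staggered_dg"
  assumes mesh: "staggered_mesh S"
    and E: "\<And>k q l r. E k q l r = E l r k q"
    and I: "I \<in> unknowns S" and J: "J \<in> unknowns S"
  shows "velocity_matrix S K rho E I J = velocity_matrix S K rho E J I"
proof -
  obtain i m k i' n l where IJ: "I = (i, m, k)" "J = (i', n, l)" by (cases I, cases J)
  then have *: "i \<in> elems S" "m < nphi S" "i' \<in> elems S" "n < nphi S"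
    using I J by (auto simp: unknowns_def)
  have face: "(\<Sum>a<npsi S j. \<Sum>b<npsi S j. \<Sum>q\<in>UNIV. \<Sum>r\<in>UNIV.
        Q_mat S i j a m q * dual_mass_inv S j $$ (a, b) * E k q l r * Q_mat S i' j b n r)
      = (\<Sum>a<npsi S j. \<Sum>b<npsi S j. \<Sum>q\<in>UNIV. \<Sum>r\<in>UNIV.
        Q_mat S i' j a n q * dual_mass_inv S j $$ (a, b) * E l q k r * Q_mat S i j b m r)"
    (is "?lhs = ?rhs") for j
  proof -
    have "?lhs = (\<Sum>b<npsi S j. \<Sum>a<npsi S j. \<Sum>q\<in>UNIV. \<Sum>r\<in>UNIV.
        Q_mat S i j a m q * dual_mass_inv S j $$ (a, b) * E k q l r * Q_mat S i' j b n r)"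
      by (rule sum.swap)
    also have "\<dots> = (\<Sum>b<npsi S j. \<Sum>a<npsi S j. \<Sum>r\<in>UNIV. \<Sum>q\<in>UNIV.
        Q_mat S i j a m q * dual_mass_inv S j $$ (a, b) * E k q l r * Q_mat S i' j b n r)"
      by (intro sum.cong refl sum.swap)
    also have "\<dots> = ?rhs"
      by (intro sum.cong refl) (simp add: dual_mass_inv_symmetric E[of k _ l] mult_ac)
    finally show ?thesis .
  qed
  have faces: "coupling_faces S K i i' = coupling_faces S K i' i"
    by (auto simp: coupling_faces_def)
  have mass: "of_bool (i = i' \<and> k = l) * main_mass S i m n
      = of_bool (i' = i \<and> l = k) * main_mass S i' n m"
    using main_mass_commute by auto
  show ?thesis
    unfolding IJ velocity_matrix_entry[OF mesh *(1,4)] velocity_matrix_entry[OF mesh *(3,2)]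
    by (simp only: mult.assoc[of rho] mass face faces)
qed

lemma isotropic_stiffness_major_symmetry:
  "isotropic_stiffness lam mu k q l r = isotropic_stiffness lam mu l r k q"
  by (auto simp: isotropic_stiffness_def)

theorem theorem1:
  fixes S :: "'d::finite staggered_dg" and K :: "nat set" and rho lam mu :: real
  assumes "CARD('d) = 2 \<or> CARD('d) = 3"
    and "staggered_dg_space S"
    and "K \<subseteq> boundary_faces S"
  shows "\<forall>I\<in>unknowns S. \<forall>J\<in>unknowns S.
    velocity_matrix S K rho (isotropic_stiffness lam mu) I J =
    velocity_matrix S K rho (isotropic_stiffness lam mu) J I"
proof -
  have "staggered_mesh S" using assms(2) by (simp add: staggered_dg_space_def)
  then show ?thesis
    by (blast intro: velocity_matrix_symmetric isotropic_stiffness_major_symmetry)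
qed

end
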